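(* Consider the channel $\Lambda^{\mathrm{Depol}}_{p}\otimes\Lambda^{\mathrm{AD}}_{\gamma}$, where $\Lambda^{\mathrm{Depol}}_{p}$ is the qubit depolarizing channel with parameter $p_s\in[0,1]$ and $\Lambda^{\mathrm{AD}}_{\gamma}$ is the qubit amplitude damping channel with damping parameter $\gamma\in[0,1]$. For fixed $p_s,\gamma$, an input state $|\psi\rangle$ yields an entangled output $(\Lambda^{\mathrm{Depol}}_{p}\otimes\Lambda^{\mathrm{AD}}_{\gamma})(|\psi\rangle\langle\psi|)$ only if the entanglement $c$ of the initial state $|\psi\rangle$ satisfies $$c<\frac{2-3p_s}{\gamma p_s-3p_s+2}.$$ In particular, for $p_s$ approaching $2/3$ from below, this implies that only weakly entangled input states can lead to an entangled output.
   Context: The depolarizing channel $\Lambda^{\mathrm{Depol}}_p$ has Kraus operators $\sqrt{1-\tfrac34 p_s}\,I$, $\sqrt{\tfrac14 p_s}\,\sigma_x$, $\sqrt{\tfrac14 p_s}\,\sigma_y$, $\sqrt{\tfrac14 p_s}\,\sigma_z$, where $\sigma_x,\sigma_y,\sigma_z$ are the Pauli matrices. The amplitude damping channel $\Lambda^{\mathrm{AD}}_\gamma$ has Kraus operators $\begin{pmatrix}1&0\\0&\sqrt{1-\gamma}\end{pmatrix}$ and $\begin{pmatrix}0&\sqrt{\gamma}\\0&0\end{pmatrix}$. A channel with Kraus operators $K_i$ acts as $\rho\mapsto\sum_iK_i\rho K_i^\dagger$. Input states are two-qubit pure states, written in Schmidt decomposition $|\psi\rangle=\sqrt{c}\,|a\rangle\otimes|b\rangle+\sqrt{1-c}\,|a^\perp\rangle\otimes|b^\perp\rangle$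 with $c\in[0,\tfrac12]$, where $\{|a\rangle,|a^\perp\rangle\}$ and $\{|b\rangle,|b^\perp\rangle\}$ are orthonormal bases of $\mathbb{C}^2$. The number $c$ (the smaller squared Schmidt coefficient, which is the geometric entanglement of $|\psi\rangle$) is what is meant by the entanglement of the initial state. A two-qubit state is entangled if it is not a convex combination of product density matrices.
   Formalization: The closing remark about p_s approaching 2/3 is stated only for γ > 0, since at γ = 0 the bound is 1 for p_s < 2/3 and a maximally entangled input (c = 1/2) keeps an entangled output for every p_s < 2/3; the main bound covers all p_s, γ in [0,1]. *)

theory Defs
  imports "HOL-Analysis.Analysis"
begin

text \<open>
  The inner product of HOL-Analysis on \<open>complex ^ 'n\<close> is the real one, so the Hermitian inner
  product is introduced here. The computational basis states of a qubit are the indices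
  \<open>1\<close> and \<open>2\<close> of \<open>complex ^ 2\<close>, in this order; a composite system is indexed by pairs.
\<close>

definition cinner :: "complex ^ 'n \<Rightarrow> complex ^ 'n \<Rightarrow> complex" where
  "cinner u v = (\<Sum>i\<in>UNIV. cnj (u $ i) * v $ i)"

definition dagger :: "complex ^ 'n ^ 'm \<Rightarrow> complex ^ 'm ^ 'n" where
  "dagger A = (\<chi> i j. cnj (A $ j $ i))"

definition kron_vec :: "complex ^ 'm \<Rightarrow> complex ^ 'n \<Rightarrow> complex ^ ('m \<times> 'n)" where
  "kron_vec u v = (\<chi> i. u $ fst i * v $ snd i)"

definition kron :: "complex ^ 'k ^ 'm \<Rightarrow> complex ^ 'l ^ 'n \<Rightarrow> complex ^ ('k \<times> 'l) ^ ('m \<times> 'n)" where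
  "kron A B = (\<chi> i j. A $ fst i $ fst j * B $ snd i $ snd j)"

definition pure_state :: "complex ^ 'n \<Rightarrow> complex ^ 'n ^ 'n" where
  "pure_state \<psi> = (\<chi> i j. \<psi> $ i * cnj (\<psi> $ j))"

definition density_matrix :: "complex ^ 'n ^ 'n \<Rightarrow> bool" where
  "density_matrix \<rho> \<longleftrightarrow>
     dagger \<rho> = \<rho> \<and> (\<forall>v. 0 \<le> Re (cinner v (\<rho> *v v))) \<and> trace \<rho> = 1"

text \<open>Meant for density matrices \<open>\<rho>\<close>.\<close>

definition entangled :: "complex ^ ('m::finite \<times> 'n::finite) ^ ('m \<times> 'n) \<Rightarrow> bool" where
  "entangled \<rho> \<longleftrightarrow>
     \<rho> \<notin> convex hull {kron \<alpha> \<beta> |\<alpha> \<beta>. density_matrix (\<alpha> :: complex ^ 'm ^ 'm) \<and>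
                                           density_matrix (\<beta> :: complex ^ 'n ^ 'n)}"

definition kraus_channel :: "(complex ^ 'm ^ 'n) list \<Rightarrow> complex ^ 'm ^ 'm \<Rightarrow> complex ^ 'n ^ 'n" where
  "kraus_channel Ks \<rho> = (\<Sum>K\<leftarrow>Ks. K ** \<rho> ** dagger K)"

text \<open>
  Kraus operators of the tensor product of two channels; see \<open>kraus_channel_kraus_tensor\<close> below.
\<close>

definition kraus_tensor ::
  "(complex ^ 'k ^ 'm) list \<Rightarrow> (complex ^ 'l ^ 'n) list \<Rightarrow> (complex ^ ('k \<times> 'l) ^ ('m \<times> 'n)) list" where
  "kraus_tensor Ks Ls = [kron K L. K \<leftarrow> Ks, L \<leftarrow> Ls]"

definition sigma_x :: "complex ^ 2 ^ 2" where
  "sigma_x = vector [vector [0, 1], vector [1, 0]]"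

definition sigma_y :: "complex ^ 2 ^ 2" where
  "sigma_y = vector [vector [0, - \<i>], vector [\<i>, 0]]"

definition sigma_z :: "complex ^ 2 ^ 2" where
  "sigma_z = vector [vector [1, 0], vector [0, - 1]]"

definition depol_kraus :: "real \<Rightarrow> (complex ^ 2 ^ 2) list" where
  "depol_kraus p =
     [sqrt (1 - 3 / 4 * p) *\<^sub>R mat 1, sqrt (1 / 4 * p) *\<^sub>R sigma_x,
      sqrt (1 / 4 * p) *\<^sub>R sigma_y, sqrt (1 / 4 * p) *\<^sub>R sigma_z]"

definition ad_kraus :: "real \<Rightarrow> (complex ^ 2 ^ 2) list" where
  "ad_kraus \<gamma> =
     [vector [vector [1, 0], vector [0, complex_of_real (sqrt (1 - \<gamma>))]],
      vector [vector [0, complex_of_real (sqrt \<gamma>)], vector [0, 0]]]"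

definition depol_ad :: "real \<Rightarrow> real \<Rightarrow> complex ^ (2 \<times> 2) ^ (2 \<times> 2) \<Rightarrow> complex ^ (2 \<times> 2) ^ (2 \<times> 2)" where
  "depol_ad p \<gamma> = kraus_channel (kraus_tensor (depol_kraus p) (ad_kraus \<gamma>))"

text \<open>Two orthonormal vectors of \<open>complex ^ 2\<close> automatically form a basis.\<close>

definition orthonormal_pair :: "complex ^ 2 \<Rightarrow> complex ^ 2 \<Rightarrow> bool" where
  "orthonormal_pair u v \<longleftrightarrow> cinner u u = 1 \<and> cinner v v = 1 \<and> cinner u v = 0"

text \<open>
  \<open>has_entanglement \<psi> c\<close>: \<open>\<psi>\<close> is a two-qubit pure state with a Schmidt decomposition whose
  smaller squared coefficient is \<open>c\<close>.
\<close>

definition has_entanglement :: "complex ^ (2 \<times> 2) \<Rightarrow> real \<Rightarrow> bool" where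
  "has_entanglement \<psi> c \<longleftrightarrow>
     0 \<le> c \<and> c \<le> 1 / 2 \<and>
     (\<exists>a a' b b'. orthonormal_pair a a' \<and> orthonormal_pair b b' \<and>
        \<psi> = sqrt c *\<^sub>R kron_vec a b + sqrt (1 - c) *\<^sub>R kron_vec a' b')"

lemma kron_mult: "kron A B ** kron C D = kron (A ** C) (B ** D)"
  by (simp add: kron_def matrix_matrix_mult_def vec_eq_iff UNIV_Times_UNIV [symmetric]
      sum.cartesian_product' sum_product mult_ac del: UNIV_Times_UNIV)

lemma dagger_kron: "dagger (kron A B) = kron (dagger A) (dagger B)"
  by (simp add: dagger_def kron_def vec_eq_iff)

lemma kron_sum_list_right:
  "kron A (\<Sum>x\<leftarrow>xs. f x) = (\<Sum>x\<leftarrow>xs. kron A (f x))"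
  by (induction xs) (simp_all add: kron_def vec_eq_iff algebra_simps)

lemma kron_add_left: "kron (A + A') B = kron A B + kron A' B"
  by (simp add: kron_def vec_eq_iff algebra_simps)

lemma kraus_channel_kraus_tensor:
  "kraus_channel (kraus_tensor Ks Ls) (kron A B) = kron (kraus_channel Ks A) (kraus_channel Ls B)"
proof (induction Ks)
  case Nil
  show ?case by (simp add: kraus_channel_def kraus_tensor_def kron_def vec_eq_iff)
next
  case (Cons K Ks)
  have "(\<Sum>M\<leftarrow>map (kron K) Ls. M ** kron A B ** dagger M)
      = kron (K ** A ** dagger K) (kraus_channel Ls B)"
    by (simp add: kraus_channel_def kron_sum_list_right kron_mult dagger_kron o_def)
  with Cons show ?case
    by (simp add: kraus_channel_def kraus_tensor_def kron_add_left)
qed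

end

theory Submission
  imports Defs
begin

text \<open>
  The Schmidt vector is rewritten as \<open>\<psi> = e \<otimes> \<beta> + e' \<otimes> \<beta>'\<close> with an orthonormal pair \<open>e, e'\<close>
  chosen so that \<open>\<beta>\<close> has no excited component; then \<open>|\<beta>|\<^sup>2 \<le> 1 - c\<close> and the excited
  component \<open>y\<close> of \<open>\<beta>'\<close> has \<open>|y|\<^sup>2 \<ge> c\<close>. Since the depolarizing channel treats all bases alike,
  the output is, with \<open>\<beta> = x f\<close>, \<open>f\<close> the ground state and \<open>g\<close> the undamped image of \<open>\<beta>'\<close>, a sum of
  projectors on product vectors built from \<open>e, e', f, g\<close> and of \<open>1 - p\<close> times the projector on
  \<open>x e \<otimes> f + e' \<otimes> g\<close>. The coherence of the latter can be absorbed by the weights of \<open>e \<otimes> g\<close> and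
  \<open>e' \<otimes> f\<close> as soon as \<open>(2 - 3 p) |x|\<^sup>2 \<le> p \<gamma> |y|\<^sup>2\<close>, hence whenever
  \<open>(2 - 3 p) (1 - c) \<le> p \<gamma> c\<close>.
\<close>

section \<open>Hermitian inner product, product vectors and rank-one projectors\<close>

definition outer :: "complex ^ 'm \<Rightarrow> complex ^ 'n \<Rightarrow> complex ^ 'n ^ 'm" where
  "outer u v = (\<chi> i j. u $ i * cnj (v $ j))"

lemma sum_UNIV_prod: "(\<Sum>i\<in>UNIV. f i) = (\<Sum>i\<in>UNIV. \<Sum>j\<in>UNIV. f (i, j))"
  for f :: "'m::finite \<times> 'n::finite \<Rightarrow> 'a::comm_monoid_add"
  by (simp add: UNIV_Times_UNIV [symmetric] sum.cartesian_product' del: UNIV_Times_UNIV)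

lemma cinner_self: "cinner u u = of_real ((norm u)\<^sup>2)"
proof -
  have "(norm u)\<^sup>2 = (\<Sum>i\<in>UNIV. (norm (u $ i))\<^sup>2)"
    by (simp add: norm_vec_def L2_set_def sum_nonneg)
  then show ?thesis
    by (simp add: cinner_def complex_norm_square mult.commute del: of_real_power)
qed

lemma cinner_commute: "cinner v u = cnj (cinner u v)"
  by (simp add: cinner_def mult.commute)

lemma cinner_add_left: "cinner (u + u') v = cinner u v + cinner u' v"
  by (simp add: cinner_def algebra_simps sum.distrib)

lemma cinner_add_right: "cinner u (v + v') = cinner u v + cinner u v'"
  by (simp add: cinner_def algebra_simps sum.distrib)

lemma cinner_scale_left: "cinner (a *s u) v = cnj a * cinner u v"
  by (simp add: cinner_def algebra_simps sum_distrib_left)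

lemma cinner_scale_right: "cinner u (a *s v) = a * cinner u v"
  by (simp add: cinner_def algebra_simps sum_distrib_left)

lemma cinner_axis: "cinner (axis i 1) u = u $ i"
  by (simp add: cinner_def axis_def if_distrib[of cnj] if_distrib[of "\<lambda>x. x * _"] cong: if_cong)

lemma cinner_kron_vec: "cinner (kron_vec u v) (kron_vec u' v') = cinner u u' * cinner v v'"
  by (simp add: cinner_def kron_vec_def sum_UNIV_prod sum_product algebra_simps)

lemma trace_pure_state: "trace (pure_state u) = of_real ((norm u)\<^sup>2)"
  by (simp add: cinner_self [symmetric] cinner_def trace_def pure_state_def mult.commute
      del: of_real_power)

lemma trace_scaleR: "trace (r *\<^sub>R A) = r *\<^sub>R trace A"
  for A :: "complex ^ 'n ^ 'n"
  by (simp add: trace_def scaleR_sum_right)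

lemma trace_kron: "trace (kron A B) = trace A * trace B"
  by (simp add: trace_def kron_def sum_UNIV_prod sum_product)

lemma pure_state_scale: "pure_state (a *s u) = (cmod a)\<^sup>2 *\<^sub>R pure_state u"
  unfolding pure_state_def vec_eq_iff vector_scaleR_component
  by (simp add: scaleR_conv_of_real complex_norm_square algebra_simps del: of_real_power)

lemma kron_vec_scale_left: "kron_vec (a *s u) v = a *s kron_vec u v"
  by (simp add: kron_vec_def vec_eq_iff)

lemma kron_vec_scale_right: "kron_vec u (a *s v) = a *s kron_vec u v"
  by (simp add: kron_vec_def vec_eq_iff)

lemma pure_state_kron_vec: "pure_state (kron_vec u v) = kron (pure_state u) (pure_state v)"
  by (simp add: pure_state_def kron_vec_def kron_def vec_eq_iff)

lemma density_matrix_pure_state: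
  assumes "norm u = 1"
  shows "density_matrix (pure_state u)"
proof -
  have "cinner v (pure_state u *v v) = of_real ((cmod (cinner u v))\<^sup>2)" for v
  proof -
    have "cinner v (pure_state u *v v) = cinner v u * cinner u v"
      by (simp add: cinner_def pure_state_def matrix_vector_mult_def sum_product
          sum_distrib_left mult_ac) (rule sum.swap)
    then show ?thesis
      by (simp add: cinner_commute [of v u] complex_norm_square mult.commute del: of_real_power)
  qed
  moreover have "dagger (pure_state u) = pure_state u"
    by (simp add: dagger_def pure_state_def vec_eq_iff)
  ultimately show ?thesis
    using assms by (simp add: density_matrix_def trace_pure_state)
qed

subsection \<open>The cone of unnormalised separable states\<close>

text \<open>In a cone, unnormalised product terms can be added and scaled without tracking weights;
  the trace recovers the normalisation at the end.\<close>

definition separable_cone :: "(complex ^ ('m::finite \<times> 'n::finite) ^ ('m \<times> 'n)) set" where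
  "separable_cone = convex_cone hull
     {kron \<alpha> \<beta> |\<alpha> \<beta>. density_matrix (\<alpha> :: complex ^ 'm ^ 'm) \<and>
                     density_matrix (\<beta> :: complex ^ 'n ^ 'n)}"

lemma separable_cone_0: "0 \<in> separable_cone"
  by (simp add: separable_cone_def convex_cone_hull_contains_0)

lemma separable_cone_add: "x \<in> separable_cone \<Longrightarrow> y \<in> separable_cone \<Longrightarrow> x + y \<in> separable_cone"
  by (simp add: separable_cone_def convex_cone_hull_add)

lemma separable_cone_scaleR: "0 \<le> r \<Longrightarrow> x \<in> separable_cone \<Longrightarrow> r *\<^sub>R x \<in> separable_cone"
  by (simp add: separable_cone_def convex_cone_hull_mul)

text \<open>The trace is linear and equals one on every product of density matrices, so a multiple
  \<open>r *\<^sub>R \<sigma>\<close> of a hull element with trace one has \<open>r = 1\<close> and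
  lies in the hull itself.\<close>

lemma not_entangled_if_separable_cone:
  fixes \<rho> :: "complex ^ ('m::finite \<times> 'n::finite) ^ ('m \<times> 'n)"
  assumes "\<rho> \<in> separable_cone" and "trace \<rho> = 1"
  shows "\<not> entangled \<rho>"
proof -
  let ?D = "{kron \<alpha> \<beta> |\<alpha> \<beta>. density_matrix (\<alpha> :: complex ^ 'm ^ 'm) \<and>
                           density_matrix (\<beta> :: complex ^ 'n ^ 'n)}"
  have "?D \<subseteq> {\<sigma>. trace \<sigma> = 1}"
    by (auto simp: trace_kron density_matrix_def)
  moreover have "convex {\<sigma> :: complex ^ ('m \<times> 'n) ^ ('m \<times> 'n). trace \<sigma> = 1}"
    by (simp add: convex_def trace_add trace_scaleR) (simp add: scaleR_conv_of_real flip: of_real_add)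
  ultimately have hull: "convex hull ?D \<subseteq> {\<sigma>. trace \<sigma> = 1}"
    by (rule hull_minimal)
  have "\<rho> \<noteq> 0"
    using assms(2) by (auto simp: trace_def)
  then obtain \<sigma> r where \<sigma>: "\<sigma> \<in> convex hull ?D" "\<rho> = r *\<^sub>R \<sigma>"
    using assms(1) unfolding separable_cone_def convex_cone_hull_convex_hull by auto
  moreover have "trace \<sigma> = 1"
    using hull \<sigma>(1) by blast
  ultimately have "r = 1"
    using assms(2) by (simp add: trace_scaleR) (simp add: scaleR_conv_of_real)
  then show ?thesis
    using \<sigma> by (simp add: entangled_def)
qed

text \<open>Normalising both factors moves their norms into a nonnegative coefficient.\<close>

lemma pure_product_in_separable_cone: "pure_state (kron_vec u v) \<in> separable_cone"
proof (cases "u = 0 \<or> v = 0")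
  case True
  then have "pure_state (kron_vec u v) = 0"
    by (auto simp: pure_state_def kron_vec_def vec_eq_iff)
  then show ?thesis
    by (simp add: separable_cone_0)
next
  case False
  define u1 where "u1 = of_real (inverse (norm u)) *s u"
  define v1 where "v1 = of_real (inverse (norm v)) *s v"
  have n: "norm (of_real r *s w) = \<bar>r\<bar> * norm w" for r and w :: "complex ^ 'k"
  proof -
    have "of_real r *s w = r *\<^sub>R w"
      unfolding vec_eq_iff vector_scaleR_component by (simp add: scaleR_conv_of_real)
    then show ?thesis by simp
  qed
  have u: "norm u1 = 1" "u = of_real (norm u) *s u1"
    unfolding u1_def n using False by (simp_all add: vector_smult_assoc)
  have v: "norm v1 = 1" "v = of_real (norm v) *s v1"
    unfolding v1_def n using False by (simp_all add: vector_smult_assoc)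
  have "kron (pure_state u1) (pure_state v1) \<in> separable_cone"
    unfolding separable_cone_def
    using density_matrix_pure_state[OF u(1)] density_matrix_pure_state[OF v(1)]
    by (intro hull_inc) blast
  moreover have "pure_state (kron_vec u v)
      = ((norm u)\<^sup>2 * (norm v)\<^sup>2) *\<^sub>R kron (pure_state u1) (pure_state v1)"
    by (subst u(2), subst v(2))
      (simp add: kron_vec_scale_left kron_vec_scale_right pure_state_scale pure_state_kron_vec
        norm_mult power_mult_distrib mult.commute)
  ultimately show ?thesis
    by (simp add: separable_cone_scaleR)
qed

text \<open>All cross terms carry \<open>z\<close>, \<open>z^2\<close> or a conjugate of these, and
  both powers sum to zero over the fourth roots of unity. The signs \<open>1\<close> and
  \<open>-1\<close> alone would leave the cross terms of \<open>Q\<close> and \<open>R\<close>,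
  which carry the squares.\<close>

lemma pure_state_phase_average:
  "(\<Sum>z\<leftarrow>[1, -1, \<i>, -\<i>]. pure_state (P + z *s Q + cnj z *s R))
     = 4 *\<^sub>R (pure_state P + pure_state Q + pure_state R)"
  unfolding pure_state_def vec_eq_iff vector_scaleR_component
  by (simp add: scaleR_conv_of_real algebra_simps)

text \<open>
  The two product terms are paid for by averaging the product vectors
  \<open>(r x e + z e') \<otimes> (f / r + cnj z g)\<close> over the fourth roots of unity \<open>z\<close>,
  which keeps the coherence between \<open>e \<otimes> f\<close> and \<open>e' \<otimes> g\<close> and removes all others.
\<close>

lemma pure_plus_products_in_separable_cone:
  fixes q A B :: real
  assumes "0 \<le> q" "0 \<le> A" "0 \<le> B" and le: "q\<^sup>2 * (cmod x)\<^sup>2 \<le> A * B"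
  shows "q *\<^sub>R pure_state (x *s kron_vec e f + kron_vec e' g)
     + A *\<^sub>R pure_state (kron_vec e g) + B *\<^sub>R pure_state (kron_vec e' f) \<in> separable_cone"
proof (cases "q = 0 \<or> B = 0")
  case True
  \<comment> \<open>Here there is no coherence and only product projectors remain; otherwise
    \<open>q\<close> and \<open>B\<close> are positive and so is \<open>r\<close> below.\<close>
  then have "q = 0 \<or> x = 0"
    using le by (auto simp: mult_le_0_iff)
  then have *: "q *\<^sub>R pure_state (x *s kron_vec e f + kron_vec e' g)
      = q *\<^sub>R pure_state (kron_vec e' g)"
    by auto
  then show ?thesis
    unfolding *
    by (intro separable_cone_add separable_cone_scaleR pure_product_in_separable_cone assms)
next
  case False
  then have pos: "q > 0" "B > 0"
    using assms by auto
  \<comment> \<open>Scaled by \<open>q\<close>, the average gives \<open>e' \<otimes> f\<close> the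
    weight \<open>q / r^2\<close>, which this choice makes exactly \<open>B\<close>;
    \<open>e \<otimes> g\<close> then gets \<open>q * r^2 * |x|^2 = q^2 * |x|^2 / B\<close>, at most
    \<open>A\<close>.\<close>
  define r where "r = sqrt (q / B)"
  have r: "r > 0" "r\<^sup>2 = q / B"
    using pos by (simp_all add: r_def)
  let ?w = "\<lambda>z. kron_vec ((of_real r * x) *s e + z *s e') (of_real (1 / r) *s f + cnj z *s g)"
  let ?P = "x *s kron_vec e f + kron_vec e' g"
  let ?Q = "of_real (1 / r) *s kron_vec e' f"
  let ?R = "(of_real r * x) *s kron_vec e g"
  have w: "?w z = ?P + z *s ?Q + cnj z *s ?R" if "z * cnj z = 1" for z
  proof -
    have "?w z = (of_real r * of_real (1 / r)) *s (x *s kron_vec e f)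
        + (z * cnj z) *s kron_vec e' g + z *s ?Q + cnj z *s ?R"
      unfolding kron_vec_def vec_eq_iff by (simp add: algebra_simps)
    moreover have "of_real r * of_real (1 / r) = (1 :: complex)"
      using r(1) by simp
    ultimately show ?thesis
      using that by simp
  qed
  have "(\<Sum>z\<leftarrow>[1, -1, \<i>, -\<i>]. pure_state (?w z)) \<in> separable_cone"
    by (simp add: separable_cone_add separable_cone_scaleR pure_product_in_separable_cone)
  also have "(\<Sum>z\<leftarrow>[1, -1, \<i>, -\<i>]. pure_state (?w z))
      = (\<Sum>z\<leftarrow>[1, -1, \<i>, -\<i>]. pure_state (?P + z *s ?Q + cnj z *s ?R))"
    by (rule arg_cong[where f = sum_list], rule map_cong[OF refl]) (subst w, auto)
  also have "\<dots> = 4 *\<^sub>R (pure_state ?P + pure_state ?Q + pure_state ?R)"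
    by (rule pure_state_phase_average)
  finally have "(q / 4) *\<^sub>R 4 *\<^sub>R (pure_state ?P + pure_state ?Q + pure_state ?R) \<in> separable_cone"
    by (rule separable_cone_scaleR[rotated]) (use pos in simp)
  also have "(q / 4) *\<^sub>R 4 *\<^sub>R (pure_state ?P + pure_state ?Q + pure_state ?R)
     = q *\<^sub>R pure_state ?P + B *\<^sub>R pure_state (kron_vec e' f)
       + (q\<^sup>2 * (cmod x)\<^sup>2 / B) *\<^sub>R pure_state (kron_vec e g)"
    using pos r(1) by (simp add: pure_state_scale scaleR_add_right norm_mult norm_divide power_mult_distrib r(2)
        power_divide power2_eq_square[of q])
  finally have "q *\<^sub>R pure_state ?P + B *\<^sub>R pure_state (kron_vec e' f)
       + (q\<^sup>2 * (cmod x)\<^sup>2 / B) *\<^sub>R pure_state (kron_vec e g) \<in> separable_cone" .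
  moreover have "(A - q\<^sup>2 * (cmod x)\<^sup>2 / B) *\<^sub>R pure_state (kron_vec e g) \<in> separable_cone"
    using pos le by (intro separable_cone_scaleR pure_product_in_separable_cone)
      (simp add: field_simps)
  ultimately have "(q *\<^sub>R pure_state ?P + B *\<^sub>R pure_state (kron_vec e' f)
       + (q\<^sup>2 * (cmod x)\<^sup>2 / B) *\<^sub>R pure_state (kron_vec e g))
       + (A - q\<^sup>2 * (cmod x)\<^sup>2 / B) *\<^sub>R pure_state (kron_vec e g) \<in> separable_cone"
    by (rule separable_cone_add)
  then show ?thesis
    by (simp add: algebra_simps)
qed

subsection \<open>Orthonormal bases of a qubit\<close>

lemma norm_orthonormal_combination:
  assumes "orthonormal_pair u v"
  shows "(norm (s *s u + t *s v))\<^sup>2 = (cmod s)\<^sup>2 + (cmod t)\<^sup>2"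
proof -
  have "complex_of_real ((norm (s *s u + t *s v))\<^sup>2) = of_real ((cmod s)\<^sup>2 + (cmod t)\<^sup>2)"
    using assms cinner_commute[of v u]
    by (simp add: orthonormal_pair_def cinner_self[symmetric] cinner_add_left cinner_add_right
        cinner_scale_left cinner_scale_right complex_norm_square mult.commute del: of_real_power)
  then show ?thesis
    by (simp only: of_real_eq_iff)
qed

lemma norm_kron_orthonormal:
  assumes "orthonormal_pair u v"
  shows "(norm (kron_vec u \<beta> + kron_vec v \<beta>'))\<^sup>2 = (norm \<beta>)\<^sup>2 + (norm \<beta>')\<^sup>2"
proof -
  have "complex_of_real ((norm (kron_vec u \<beta> + kron_vec v \<beta>'))\<^sup>2)
      = of_real ((norm \<beta>)\<^sup>2 + (norm \<beta>')\<^sup>2)"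
    unfolding of_real_add cinner_self[symmetric]
    using assms cinner_commute[of v u]
    by (simp add: orthonormal_pair_def cinner_add_left cinner_add_right cinner_kron_vec)
  then show ?thesis
    by (simp only: of_real_eq_iff)
qed

text \<open>For the square matrix \<open>U\<close> with columns \<open>u\<close> and
  \<open>v\<close>, orthonormality says \<open>dagger U ** U = mat 1\<close>, and a left inverse is
  also a right inverse.\<close>

lemma orthonormal_pair_complete:
  assumes "orthonormal_pair u v"
  shows "outer u u + outer v v = mat 1"
proof -
  define U :: "complex ^ 2 ^ 2" where "U = (\<chi> i j. if j = 1 then u $ i else v $ i)"
  have "dagger U ** U = mat 1"
    using assms cinner_commute[of v u]
    by (simp add: orthonormal_pair_def U_def dagger_def matrix_matrix_mult_def mat_def cinner_def
        vec_eq_iff forall_2)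
  then have "U ** dagger U = mat 1"
    by (simp add: matrix_left_right_inverse)
  then show ?thesis
    by (simp add: U_def dagger_def matrix_matrix_mult_def outer_def vec_eq_iff sum_2 forall_2)
qed

lemma orthonormal_pair_expand:
  assumes "orthonormal_pair u v"
  shows "w = cinner u w *s u + cinner v w *s v"
proof -
  have "w = (outer u u + outer v v) *v w"
    using orthonormal_pair_complete[OF assms] by simp
  also have "\<dots> = cinner u w *s u + cinner v w *s v"
    by (simp add: outer_def matrix_vector_mult_def cinner_def vec_eq_iff sum_2 algebra_simps)
  finally show ?thesis .
qed

lemma orthonormal_pair_parseval:
  assumes "orthonormal_pair u v"
  shows "(cmod (cinner w u))\<^sup>2 + (cmod (cinner w v))\<^sup>2 = (norm w)\<^sup>2"
proof -
  have "(norm w)\<^sup>2 = (norm (cinner u w *s u + cinner v w *s v))\<^sup>2"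
    using orthonormal_pair_expand[OF assms, of w] by simp
  then show ?thesis
    by (simp add: norm_orthonormal_combination[OF assms] cinner_commute[of _ w])
qed

text \<open>Aligns \<open>e'\<close> with a given vector, so that the component along
  \<open>e\<close> disappears.\<close>

lemma exists_orthonormal_pair_parallel:
  fixes v :: "complex ^ 2"
  obtains e e' where "orthonormal_pair e e'" "cinner e v = 0" "cmod (cinner e' v) = norm v"
proof -
  obtain e' :: "complex ^ 2" and k where e': "norm e' = 1" and v: "v = k *s e'"
  proof (cases "v = 0")
    case True
    then show ?thesis
      using that[of "axis 1 1" 0] by (simp add: norm_axis_1)
  next
    case False
    have "v = of_real (norm v) *s (v /\<^sub>R norm v)"
      unfolding vec_eq_iff vector_smult_component vector_scaleR_component
      by (simp add: scaleR_conv_of_real False)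
    then show ?thesis
      using that[of "v /\<^sub>R norm v"] False by simp
  qed
  \<comment> \<open>The antiunitary flip of \<open>e'\<close>, orthogonal to it in dimension
    two.\<close>
  define e :: "complex ^ 2" where "e = vector [- cnj (e' $ 2), cnj (e' $ 1)]"
  have c: "cinner e' e' = 1"
    using e' by (simp add: cinner_self)
  then have "cinner e e = 1" "cinner e e' = 0"
    by (simp_all add: e_def cinner_def sum_2 algebra_simps)
  moreover from this have o: "orthonormal_pair e e'"
    using c by (simp add: orthonormal_pair_def)
  moreover have "norm v = cmod k"
    using norm_orthonormal_combination[OF o, of 0 k] by (simp add: v)
  ultimately show thesis
    using c by (intro that[of e e']) (simp_all add: v cinner_scale_right)
qed

subsection \<open>The output of the channel\<close>

lemma kraus_channel_add: "kraus_channel Ks (A + B) = kraus_channel Ks A + kraus_channel Ks B"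
proof -
  have *: "(M + N) ** P = M ** P + N ** P" for M N :: "complex ^ 'm ^ 'n" and P :: "complex ^ 'k ^ 'm"
    by (simp add: vec_eq_iff matrix_matrix_mult_def algebra_simps sum.distrib)
  show ?thesis
    by (induction Ks) (simp_all add: kraus_channel_def matrix_add_ldistrib * algebra_simps)
qed

lemma kraus_channel_outer:
  "kraus_channel Ks (outer u v) = (\<Sum>K\<leftarrow>Ks. outer (K *v u) (K *v v))"
  for Ks :: "(complex ^ 'm ^ 'n) list"
proof -
  have "K ** outer u v ** dagger K = outer (K *v u) (K *v v)" for K :: "complex ^ 'm ^ 'n"
    by (simp add: outer_def dagger_def matrix_matrix_mult_def matrix_vector_mult_def vec_eq_iff
        sum_product sum_distrib_left sum_distrib_right mult_ac)
  then show ?thesis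
    by (simp add: kraus_channel_def)
qed

text \<open>The three Pauli conjugates of \<open>A\<close> sum to \<open>2 * trace A\<close> times
  the identity minus \<open>A\<close>. The resulting form refers to no basis, which permits
  computing in any orthonormal pair.\<close>

lemma kraus_channel_depol:
  assumes "0 \<le> p" "p \<le> 1"
  shows "kraus_channel (depol_kraus p) A = (1 - p) *\<^sub>R A + mat (of_real (p / 2) * trace A)"
proof -
  have *: "(r *\<^sub>R M) ** A ** dagger (r *\<^sub>R M) = r\<^sup>2 *\<^sub>R (M ** A ** dagger M)"
    for r and M :: "complex ^ 2 ^ 2"
    by (simp add: vec_eq_iff dagger_def matrix_matrix_mult_def power2_eq_square scaleR_sum_right
        sum_distrib_left sum_distrib_right algebra_simps)
  have sq: "(sqrt (1 - 3 / 4 * p))\<^sup>2 = 1 - 3 / 4 * p" "(sqrt (1 / 4 * p))\<^sup>2 = 1 / 4 * p"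
    using assms by simp_all
  show ?thesis
    unfolding kraus_channel_def depol_kraus_def list.map * sum_list.Cons sum_list.Nil sq
      vec_eq_iff vector_add_component vector_scaleR_component
    by (simp add: forall_2 dagger_def matrix_matrix_mult_def sum_2 sigma_x_def
        sigma_y_def sigma_z_def mat_def trace_def scaleR_conv_of_real field_simps)
qed

text \<open>The diagonal operators have trace one and acquire a multiple of the identity, resolved
  in the given pair; the off-diagonal ones have trace zero and only shrink.\<close>

lemma depol_outer:
  assumes "0 \<le> p" "p \<le> 1" "orthonormal_pair e e'"
  shows "kraus_channel (depol_kraus p) (outer e e)
        = (1 - p) *\<^sub>R outer e e + (p / 2) *\<^sub>R (outer e e + outer e' e')"
    and "kraus_channel (depol_kraus p) (outer e' e')
        = (1 - p) *\<^sub>R outer e' e' + (p / 2) *\<^sub>R (outer e e + outer e' e')"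
    and "kraus_channel (depol_kraus p) (outer e e') = (1 - p) *\<^sub>R outer e e'"
    and "kraus_channel (depol_kraus p) (outer e' e) = (1 - p) *\<^sub>R outer e' e"
proof -
  have t: "trace (outer u v) = cinner v u" for u v :: "complex ^ 2"
    by (simp add: trace_def outer_def cinner_def mult.commute)
  have m: "mat (of_real (p / 2)) = (p / 2) *\<^sub>R (mat 1 :: complex ^ 2 ^ 2)"
    unfolding vec_eq_iff vector_scaleR_component by (simp add: mat_def scaleR_conv_of_real)
  have "mat 0 = (0 :: complex ^ 2 ^ 2)"
    by (simp add: mat_def vec_eq_iff)
  then show "kraus_channel (depol_kraus p) (outer e e)
        = (1 - p) *\<^sub>R outer e e + (p / 2) *\<^sub>R (outer e e + outer e' e')"
    "kraus_channel (depol_kraus p) (outer e' e')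
        = (1 - p) *\<^sub>R outer e' e' + (p / 2) *\<^sub>R (outer e e + outer e' e')"
    "kraus_channel (depol_kraus p) (outer e e') = (1 - p) *\<^sub>R outer e e'"
    "kraus_channel (depol_kraus p) (outer e' e) = (1 - p) *\<^sub>R outer e' e"
    using assms(3) cinner_commute[of e' e] m
    by (simp_all only: orthonormal_pair_complete kraus_channel_depol[OF assms(1,2)] t
        orthonormal_pair_def mult_1_right mult_zero_right complex_cnj_zero add_0_right)
qed

text \<open>All four blocks in the basis \<open>e, e'\<close> shrink by the same factor
  \<open>1 - p\<close> and so reassemble to a projector; the identity parts of the diagonal blocks
  give the product terms.\<close>

lemma depol_ad_pure_state:
  assumes "0 \<le> p" "p \<le> 1" "orthonormal_pair e e'"
  shows "depol_ad p \<gamma> (pure_state (kron_vec e \<beta> + kron_vec e' \<beta>'))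
     = (\<Sum>L\<leftarrow>ad_kraus \<gamma>.
          (1 - p) *\<^sub>R pure_state (kron_vec e (L *v \<beta>) + kron_vec e' (L *v \<beta>'))
        + (p / 2) *\<^sub>R (pure_state (kron_vec e (L *v \<beta>)) + pure_state (kron_vec e' (L *v \<beta>))
                     + pure_state (kron_vec e (L *v \<beta>')) + pure_state (kron_vec e' (L *v \<beta>'))))"
proof -
  have split: "pure_state (kron_vec e u + kron_vec e' u')
      = kron (outer e e) (outer u u) + kron (outer e e') (outer u u')
      + kron (outer e' e) (outer u' u) + kron (outer e' e') (outer u' u')" for u u' :: "complex ^ 2"
    by (simp add: vec_eq_iff pure_state_def kron_vec_def kron_def outer_def algebra_simps)
  have product: "pure_state (kron_vec u v) = kron (outer u u) (outer v v)" for u v :: "complex ^ 2"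
    by (simp add: vec_eq_iff pure_state_def kron_vec_def kron_def outer_def)
  have scale: "kron (r *\<^sub>R A) B = r *\<^sub>R kron A B" for r and A B :: "complex ^ 2 ^ 2"
    by (simp add: vec_eq_iff kron_def)
  have right: "kron A (B + C) = kron A B + kron A C" for A B C :: "complex ^ 2 ^ 2"
    by (simp add: vec_eq_iff kron_def algebra_simps)
  show ?thesis
    unfolding split depol_ad_def kraus_channel_add kraus_channel_kraus_tensor
      depol_outer[OF assms]
    unfolding kraus_channel_outer
    by (simp add: ad_kraus_def product kron_add_left scale right) (simp add: algebra_simps)
qed

lemma norm_power2_qubit: "(norm u)\<^sup>2 = (cmod (u $ 1))\<^sup>2 + (cmod (u $ 2))\<^sup>2"
  for u :: "complex ^ 2"
  by (simp add: norm_vec_def L2_set_def sum_2)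

lemma norm_kron_vec: "norm (kron_vec u v) = norm u * norm v"
proof -
  have "complex_of_real ((norm (kron_vec u v))\<^sup>2) = of_real ((norm u * norm v)\<^sup>2)"
    unfolding power_mult_distrib of_real_mult cinner_self[symmetric] by (rule cinner_kron_vec)
  then show ?thesis
    by (simp only: of_real_eq_iff power2_eq_iff_nonneg norm_ge_zero mult_nonneg_nonneg)
qed

text \<open>In each damping branch \<open>1 - p\<close> and twice \<open>p / 2\<close> add to one;
  summing over the branches, amplitude damping preserves the total squared norm.\<close>

lemma trace_depol_ad:
  assumes "0 \<le> p" "p \<le> 1" "0 \<le> \<gamma>" "\<gamma> \<le> 1" "orthonormal_pair e e'"
  shows "trace (depol_ad p \<gamma> (pure_state (kron_vec e \<beta> + kron_vec e' \<beta>')))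
     = of_real ((norm \<beta>)\<^sup>2 + (norm \<beta>')\<^sup>2)"
proof -
  have "(norm e)\<^sup>2 = 1" "(norm e')\<^sup>2 = 1"
    using assms(5) unfolding orthonormal_pair_def cinner_self of_real_eq_1_iff by auto
  then have n: "trace ((1 - p) *\<^sub>R pure_state (kron_vec e u + kron_vec e' u')
        + (p / 2) *\<^sub>R (pure_state (kron_vec e u) + pure_state (kron_vec e' u)
                     + pure_state (kron_vec e u') + pure_state (kron_vec e' u')))
      = of_real ((norm u)\<^sup>2 + (norm u')\<^sup>2)" for u u' :: "complex ^ 2"
    unfolding trace_add trace_scaleR trace_pure_state norm_kron_orthonormal[OF assms(5)]
      norm_kron_vec power_mult_distrib
    by (simp add: scaleR_conv_of_real algebra_simps)
  have ad: "(\<Sum>L\<leftarrow>ad_kraus \<gamma>. (norm (L *v u))\<^sup>2) = (norm u)\<^sup>2" for u :: "complex ^ 2"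
    using assms(3,4)
    by (simp add: ad_kraus_def norm_power2_qubit matrix_vector_mult_def sum_2 norm_mult
        power_mult_distrib algebra_simps)
  have "trace (\<Sum>L\<leftarrow>Ls. F L) = (\<Sum>L\<leftarrow>Ls. trace (F L))"
    for Ls :: "(complex ^ 2 ^ 2) list" and F :: "_ \<Rightarrow> complex ^ (2 \<times> 2) ^ (2 \<times> 2)"
    by (induction Ls) (simp_all add: trace_add trace_0[unfolded mat_0])
  then have "trace (depol_ad p \<gamma> (pure_state (kron_vec e \<beta> + kron_vec e' \<beta>')))
      = (\<Sum>L\<leftarrow>ad_kraus \<gamma>. of_real ((norm (L *v \<beta>))\<^sup>2 + (norm (L *v \<beta>'))\<^sup>2))"
    by (simp only: depol_ad_pure_state[OF assms(1,2,5)] n)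
  also have "\<dots> = of_real ((\<Sum>L\<leftarrow>ad_kraus \<gamma>. (norm (L *v \<beta>))\<^sup>2) + (\<Sum>L\<leftarrow>ad_kraus \<gamma>. (norm (L *v \<beta>'))\<^sup>2))"
    by (simp add: ad_kraus_def)
  finally show ?thesis
    by (simp only: ad)
qed

text \<open>With \<open>\<beta>\<close> in the ground state, decay annihilates
  \<open>e \<otimes> \<beta>\<close> and leaves a product vector, so only the branch without decay
  has a coherence. The decay branch raises the weight of \<open>e' \<otimes> f\<close> that absorbs
  it.\<close>

lemma depol_ad_separable:
  assumes "0 \<le> p" "p \<le> 1" "0 \<le> \<gamma>" "\<gamma> \<le> 1"
    and "orthonormal_pair e e'" and \<beta>: "\<beta> $ 2 = 0"
    and le: "(2 - 3 * p) * (norm \<beta>)\<^sup>2 \<le> p * \<gamma> * (cmod (\<beta>' $ 2))\<^sup>2"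
  shows "depol_ad p \<gamma> (pure_state (kron_vec e \<beta> + kron_vec e' \<beta>')) \<in> separable_cone"
proof -
  define f :: "complex ^ 2" where "f = vector [1, 0]"
  define g :: "complex ^ 2" where "g = vector [\<beta>' $ 1, of_real (sqrt (1 - \<gamma>)) * \<beta>' $ 2]"
  define x where "x = \<beta> $ 1"
  define h where "h = of_real (sqrt \<gamma>) * \<beta>' $ 2"
  \<comment> \<open>Total weights of \<open>e \<otimes> g\<close> and \<open>e' \<otimes> f\<close>
    in the output; the decayed part of \<open>e' \<otimes> \<beta>'\<close> contributes
    \<open>(1 - p) + p / 2\<close> times \<open>|h|^2\<close> to the latter.\<close>
  define A where "A = p / 2"
  define B where "B = p / 2 * (cmod x)\<^sup>2 + (1 - p / 2) * (cmod h)\<^sup>2"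
  have AB: "0 \<le> A" "0 \<le> B"
    using assms by (simp_all add: A_def B_def)
  have h: "(cmod h)\<^sup>2 = \<gamma> * (cmod (\<beta>' $ 2))\<^sup>2"
    using assms by (simp add: h_def norm_mult power_mult_distrib)
  have x: "(norm \<beta>)\<^sup>2 = (cmod x)\<^sup>2"
    by (simp add: norm_power2_qubit \<beta> x_def)
  \<comment> \<open>Since \<open>p^2 / 4 - (1 - p)^2 = - (1 - p / 2) * (2 - 3 * p) / 2\<close>, the
    absorption condition is the hypothesis multiplied by \<open>(1 - p / 2) / 2\<close>.\<close>
  have "(1 - p / 2) / 2 * ((2 - 3 * p) * (cmod x)\<^sup>2) \<le> (1 - p / 2) / 2 * (p * (cmod h)\<^sup>2)"
    using le assms(1,2) unfolding h x by (intro mult_left_mono) (auto simp: mult.assoc)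
  moreover have "A * B - (1 - p)\<^sup>2 * (cmod x)\<^sup>2
      = (1 - p / 2) / 2 * (p * (cmod h)\<^sup>2) - (1 - p / 2) / 2 * ((2 - 3 * p) * (cmod x)\<^sup>2)"
    by (simp add: A_def B_def power2_eq_square[of "1 - p"] field_simps)
  ultimately have q: "(1 - p)\<^sup>2 * (cmod x)\<^sup>2 \<le> A * B"
    by linarith
  let ?X = "(1 - p) *\<^sub>R pure_state (x *s kron_vec e f + kron_vec e' g)
     + A *\<^sub>R pure_state (kron_vec e g) + B *\<^sub>R pure_state (kron_vec e' f)"
  have X: "?X \<in> separable_cone"
    using assms(2) AB q by (intro pure_plus_products_in_separable_cone) auto
  \<comment> \<open>First the branch without decay, then the decay branch.\<close>
  have L: "(\<Sum>L\<leftarrow>ad_kraus \<gamma>. F (L *v \<beta>) (L *v \<beta>')) = F (x *s f) g + F 0 (h *s f)"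
    for F :: "complex ^ 2 \<Rightarrow> complex ^ 2 \<Rightarrow> complex ^ (2 \<times> 2) ^ (2 \<times> 2)"
  proof -
    have "vector [vector [1, 0], vector [0, complex_of_real (sqrt (1 - \<gamma>))]] *v \<beta> = x *s f"
      "vector [vector [1, 0], vector [0, complex_of_real (sqrt (1 - \<gamma>))]] *v \<beta>' = g"
      "vector [vector [0, complex_of_real (sqrt \<gamma>)], vector [0, 0]] *v \<beta> = (0 :: complex ^ 2)"
      "vector [vector [0, complex_of_real (sqrt \<gamma>)], vector [0, 0]] *v \<beta>' = h *s f"
      by (simp_all add: vec_eq_iff forall_2 matrix_vector_mult_def sum_2 \<beta> x_def f_def g_def h_def)
    then show ?thesis
      by (simp add: ad_kraus_def)
  qed
  have zero: "kron_vec u 0 = 0" "pure_state (0 :: complex ^ (2 \<times> 2)) = 0" for u :: "complex ^ 2"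
    by (simp_all add: kron_vec_def pure_state_def vec_eq_iff)
  have "depol_ad p \<gamma> (pure_state (kron_vec e \<beta> + kron_vec e' \<beta>')) = ?X
      + (p / 2 * ((cmod x)\<^sup>2 + (cmod h)\<^sup>2)) *\<^sub>R pure_state (kron_vec e f)
      + (p / 2) *\<^sub>R pure_state (kron_vec e' g)"
    unfolding depol_ad_pure_state[OF assms(1,2,5)]
      L[of "\<lambda>u u'. (1 - p) *\<^sub>R pure_state (kron_vec e u + kron_vec e' u')
        + (p / 2) *\<^sub>R (pure_state (kron_vec e u) + pure_state (kron_vec e' u)
                     + pure_state (kron_vec e u') + pure_state (kron_vec e' u'))"]
    by (simp add: zero kron_vec_scale_right pure_state_scale A_def B_def)
      (simp only: vec_eq_iff vector_add_component vector_scaleR_component,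
        simp add: scaleR_conv_of_real field_simps)
  also have "\<dots> \<in> separable_cone"
    using assms(1)
    by (intro separable_cone_add X separable_cone_scaleR pure_product_in_separable_cone) auto
  finally show ?thesis .
qed

section \<open>From the Schmidt decomposition to the separability condition\<close>

text \<open>
  For \<open>p \<ge> 2/3\<close> the hypothesis always holds: there the depolarizing channel is entanglement breaking.
\<close>

lemma depol_ad_not_entangled:
  assumes "0 \<le> p" "p \<le> 1" "0 \<le> \<gamma>" "\<gamma> \<le> 1"
    and ent: "has_entanglement \<psi> c" and le: "(2 - 3 * p) * (1 - c) \<le> p * \<gamma> * c"
  shows "\<not> entangled (depol_ad p \<gamma> (pure_state \<psi>))"
proof -
  obtain a a' b b' where c: "0 \<le> c" "c \<le> 1 / 2"
    and a: "orthonormal_pair a a'" and b: "orthonormal_pair b b'"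
    and \<psi>: "\<psi> = sqrt c *\<^sub>R kron_vec a b + sqrt (1 - c) *\<^sub>R kron_vec a' b'"
    using ent unfolding has_entanglement_def by blast
  define s t where "s = complex_of_real (sqrt c)" and "t = complex_of_real (sqrt (1 - c))"
  have st: "(cmod s)\<^sup>2 = c" "(cmod t)\<^sup>2 = 1 - c"
    using c by (simp_all add: s_def t_def)
  have \<psi>_comp: "\<psi> $ (i, j) = s * a $ i * b $ j + t * a' $ i * b' $ j" for i j
    unfolding \<psi> vector_add_component vector_scaleR_component
    by (simp add: scaleR_conv_of_real kron_vec_def s_def t_def)
  have \<psi>_st: "\<psi> = kron_vec a (s *s b) + kron_vec a' (t *s b')"
    by (simp add: vec_eq_iff \<psi>_comp kron_vec_def mult_ac)
  \<comment> \<open>The first-qubit vector with entries \<open>\<psi> $ (i, 2)\<close>, which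
    accompanies the excited state of the damped qubit.\<close>
  define v where "v = (s * b $ 2) *s a + (t * b' $ 2) *s a'"
  obtain e e' where e: "orthonormal_pair e e'" "cinner e v = 0" "cmod (cinner e' v) = norm v"
    by (rule exists_orthonormal_pair_parallel)
  \<comment> \<open>\<open>\<beta> u\<close> is the partial inner product of \<open>u\<close> with
    \<open>\<psi>\<close> on the first qubit; its excited component \<open>cinner u v\<close>
    vanishes for \<open>e\<close> and has modulus \<open>norm v\<close> for
    \<open>e'\<close>.\<close>
  define \<beta> where "\<beta> = (\<lambda>u. (s * cinner u a) *s b + (t * cinner u a') *s b')"
  have \<beta>2: "\<beta> u $ 2 = cinner u v" for u
    by (simp add: \<beta>_def v_def cinner_add_right cinner_scale_right algebra_simps)
  have I: "u = cinner e u *s e + cinner e' u *s e'" for u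
    by (rule orthonormal_pair_expand[OF e(1)])
  have \<psi>_e: "\<psi> = kron_vec e (\<beta> e) + kron_vec e' (\<beta> e')"
    unfolding \<psi>_st by (subst I[of a], subst I[of a'])
      (simp add: vec_eq_iff kron_vec_def \<beta>_def algebra_simps)
  \<comment> \<open>The excited components of an orthonormal basis form a row of a unitary
    matrix.\<close>
  have sum1: "(cmod (b $ 2))\<^sup>2 + (cmod (b' $ 2))\<^sup>2 = 1"
    using orthonormal_pair_parseval[OF b, of "axis 2 1"]
    by (simp add: cinner_axis norm_axis_1)
  \<comment> \<open>The squared norm of \<open>v\<close> averages \<open>c\<close> and
    \<open>1 - c\<close> with weights summing to one, so it is at least the smaller value.\<close>
  have "c = c * (cmod (b $ 2))\<^sup>2 + c * (cmod (b' $ 2))\<^sup>2"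
    unfolding distrib_left[symmetric] sum1 by simp
  also have "\<dots> \<le> c * (cmod (b $ 2))\<^sup>2 + (1 - c) * (cmod (b' $ 2))\<^sup>2"
    using c by (intro add_left_mono mult_right_mono) auto
  also have "\<dots> = (cmod (\<beta> e' $ 2))\<^sup>2"
    unfolding \<beta>2 e(3) by (simp add: v_def norm_orthonormal_combination[OF a] norm_mult
        power_mult_distrib st)
  finally have lower: "c \<le> (cmod (\<beta> e' $ 2))\<^sup>2" .
  have "cinner e e = 1"
    using e(1) by (simp add: orthonormal_pair_def)
  then have "(norm e)\<^sup>2 = 1"
    unfolding cinner_self of_real_eq_1_iff .
  then have sum2: "(cmod (cinner e a))\<^sup>2 + (cmod (cinner e a'))\<^sup>2 = 1"
    by (simp add: orthonormal_pair_parseval[OF a])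
  \<comment> \<open>Again an average of \<open>c\<close> and \<open>1 - c\<close>, now bounded by
    the larger value.\<close>
  have "(norm (\<beta> e))\<^sup>2 = c * (cmod (cinner e a))\<^sup>2 + (1 - c) * (cmod (cinner e a'))\<^sup>2"
    by (simp add: \<beta>_def norm_orthonormal_combination[OF b] norm_mult power_mult_distrib st)
  also have "\<dots> \<le> (1 - c) * (cmod (cinner e a))\<^sup>2 + (1 - c) * (cmod (cinner e a'))\<^sup>2"
    using c by (intro add_right_mono mult_right_mono) auto
  also have "\<dots> = 1 - c"
    unfolding distrib_left[symmetric] sum2 by simp
  finally have upper: "(norm (\<beta> e))\<^sup>2 \<le> 1 - c" .
  have "(2 - 3 * p) * (norm (\<beta> e))\<^sup>2 \<le> p * \<gamma> * (cmod (\<beta> e' $ 2))\<^sup>2"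
  \<comment> \<open>\<open>upper\<close> may be multiplied only by a nonnegative factor; for a
    negative one the left side is nonpositive and the right side nonnegative.\<close>
  proof (cases "2 - 3 * p \<ge> 0")
    case True
    then have "(2 - 3 * p) * (norm (\<beta> e))\<^sup>2 \<le> (2 - 3 * p) * (1 - c)"
      using upper by (intro mult_left_mono)
    also note le
    also have "p * \<gamma> * c \<le> p * \<gamma> * (cmod (\<beta> e' $ 2))\<^sup>2"
      using lower assms by (intro mult_left_mono) auto
    finally show ?thesis .
  next
    case False
    then have "(2 - 3 * p) * (norm (\<beta> e))\<^sup>2 \<le> 0"
      by (intro mult_nonpos_nonneg) auto
    also have "0 \<le> p * \<gamma> * (cmod (\<beta> e' $ 2))\<^sup>2"
      using assms by simp
    finally show ?thesis .
  qed
  then have "depol_ad p \<gamma> (pure_state \<psi>) \<in> separable_cone"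
    unfolding \<psi>_e using assms e by (intro depol_ad_separable) (auto simp: \<beta>2)
  \<comment> \<open>Computed in the Schmidt basis, where the two squared norms are \<open>c\<close>
    and \<open>1 - c\<close>.\<close>
  moreover have "trace (depol_ad p \<gamma> (pure_state \<psi>)) = 1"
  proof -
    have "norm (s *s b) = cmod s" "norm (t *s b') = cmod t"
      using norm_orthonormal_combination[OF b, of s 0] norm_orthonormal_combination[OF b, of 0 t]
      by simp_all
    then show ?thesis
      unfolding \<psi>_st trace_depol_ad[OF assms(1-4) a] by (simp add: st)
  qed
  ultimately show ?thesis
    by (rule not_entangled_if_separable_cone)
qed

section \<open>The entanglement bound and its limit at \<open>p = 2 / 3\<close>\<close>

theorem proposition7:
  fixes \<gamma> :: real
  assumes "0 \<le> \<gamma>" and "\<gamma> \<le> 1"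
  shows "(\<forall>p \<psi> c. 0 \<le> p \<longrightarrow> p \<le> 1 \<longrightarrow> has_entanglement \<psi> c \<longrightarrow>
            entangled (depol_ad p \<gamma> (pure_state \<psi>)) \<longrightarrow>
            c < (2 - 3 * p) / (\<gamma> * p - 3 * p + 2))
       \<and> (0 < \<gamma> \<longrightarrow>
            (\<forall>\<epsilon>>0. \<forall>\<^sub>F p in at_left (2 / 3). \<forall>\<psi> c. has_entanglement \<psi> c \<longrightarrow>
               entangled (depol_ad p \<gamma> (pure_state \<psi>)) \<longrightarrow> c < \<epsilon>))"
proof -
  have bound: "c < (2 - 3 * p) / (\<gamma> * p - 3 * p + 2)"
    if p: "0 \<le> p" "p \<le> 1" and "has_entanglement \<psi> c"
      and "entangled (depol_ad p \<gamma> (pure_state \<psi>))" for p \<psi> c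
  proof -
    have c: "0 \<le> c" "c \<le> 1 / 2"
      using that(3) by (auto simp: has_entanglement_def)
    have gt: "p * \<gamma> * c < (2 - 3 * p) * (1 - c)"
      using depol_ad_not_entangled[OF p assms that(3)] that(4) by linarith
    moreover have "0 \<le> p * \<gamma> * c"
      using assms p c by simp
    \<comment> \<open>As \<open>1 - c > 0\<close>, entanglement forces \<open>p < 2 / 3\<close>;
      hence the denominator, \<open>2 - 3 * p\<close> plus \<open>\<gamma> * p\<close>, is positive
      and \<open>gt\<close> can be solved for \<open>c\<close>.\<close>
    ultimately have "0 < (2 - 3 * p) * (1 - c)"
      by linarith
    then have "0 < 2 - 3 * p"
      by (rule zero_less_mult_pos2) (use c in simp)
    moreover have "0 \<le> \<gamma> * p"
      using assms p by simp
    ultimately have "0 < \<gamma> * p - 3 * p + 2"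
      by linarith
    then show ?thesis
      using gt by (simp add: pos_less_divide_eq algebra_simps)
  qed
  moreover have "\<forall>\<^sub>F p in at_left (2 / 3). \<forall>\<psi> c. has_entanglement \<psi> c \<longrightarrow>
      entangled (depol_ad p \<gamma> (pure_state \<psi>)) \<longrightarrow> c < \<epsilon>" if "0 < \<gamma>" "0 < \<epsilon>" for \<epsilon>
  proof -
    \<comment> \<open>The numerator vanishes at \<open>2 / 3\<close> while the denominator tends to
      \<open>2 / 3 * \<gamma>\<close>, nonzero by \<open>0 < \<gamma>\<close>; for
      \<open>\<gamma> = 0\<close> the fraction would be constantly one below
      \<open>2 / 3\<close>.\<close>
    have "((\<lambda>p. (2 - 3 * p) / (\<gamma> * p - 3 * p + 2)) \<longlongrightarrow>
        (2 - 3 * (2 / 3)) / (\<gamma> * (2 / 3) - 3 * (2 / 3) + 2)) (at_left (2 / 3))"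
      using that by (intro tendsto_intros) auto
    then have "\<forall>\<^sub>F p in at_left (2 / 3). (2 - 3 * p) / (\<gamma> * p - 3 * p + 2) < \<epsilon>"
      using that by (intro order_tendstoD(2)) auto
    \<comment> \<open>Keeps \<open>p\<close> in the range where \<open>bound\<close>
      applies.\<close>
    moreover have "\<forall>\<^sub>F p in at_left (2 / 3 :: real). p \<in> {0<..<2 / 3}"
      by (rule eventually_at_left_real) simp
    ultimately show ?thesis
    proof eventually_elim
      case (elim p)
      then show ?case
        using bound[of p] by fastforce
    qed
  qed
  ultimately show ?thesis
    by blast
qed

end
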